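(* Let $p\ge 0$ be an integer and let $\{\phi_0,\dots,\phi_p\}$ be a basis of the real vector space $\mathbb{P}^p$ of univariate real polynomials of degree at most $p$; write $\boldsymbol{\phi}(x)=[\phi_0(x),\dots,\phi_p(x)]^T\in\mathbb{R}^{p+1}$. Let $\tilde x$ be the computational boundary point (an endpoint of the boundary cell $\Omega_b$ of length $\Delta x>0$), and let $\bar x=\tilde x+d$ with $d\in[-\Delta x,\Delta x]$ be the real boundary point. For every $\mathbf{u}\in\mathbb{R}^{p+1}$ and $u_D\in\mathbb{R}$, let $(\mathbf{v},\lambda)\in\mathbb{R}^{p+1}\times\mathbb{R}$ be the (unique) solution of the ROD-E linear system $$\begin{bmatrix} I & \boldsymbol{\phi}(\bar x)\\ \boldsymbol{\phi}(\bar x)^T & 0\end{bmatrix}\begin{bmatrix}\mathbf{v}\\ \lambda\end{bmatrix}=\begin{bmatrix}\mathbf{u}\\ u_D\end{bmatrix},$$ where $I$ is the identity matrix, and let $v_h(x)=\boldsymbol{\phi}(x)^T\mathbf{v}$. Then computing $v_h(\tilde x)$ in this way is equivalent to the polynomial correction $$v_h(\tilde x)=[\boldsymbol{\phi}^{\text{ROD-E}}(\tilde x)]^T\mathbf{u}+\alpha^{\text{ROD-E}}(\tilde x)\,u_D,$$ i.e. this equality holds for all $\mathbf{u}$ and $u_D$, where $$\alpha^{\text{ROD-E}}(\tilde x)=\frac{\boldsymbol{\phi}(\tilde x)^T\boldsymbol{\phi}(\bar x)}{\boldsymbol{\phi}(\bar x)^T\boldsymbol{\phi}(\bar x)},\qquad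 \boldsymbol{\phi}^{\text{ROD-E}}(\tilde x)=\boldsymbol{\phi}(\tilde x)-\alpha^{\text{ROD-E}}(\tilde x)\,\boldsymbol{\phi}(\bar x).$$
   Context: Setting: in a one-dimensional discontinuous Galerkin method, the numerical solution in the boundary cell $\Omega_b$ is the polynomial $u_h(x)=\boldsymbol{\phi}(x)^T\mathbf{u}$, with coefficient vector $\mathbf{u}=[u_0,\dots,u_p]^T$ in the basis $\{\phi_n\}_{n=0}^p$. Basis functions are polynomials and are evaluated also outside the cell. A Dirichlet value $u_D$ is prescribed at the real boundary point $\bar x$, which need not coincide with the computational boundary point $\tilde x$. The ROD-E (Reconstruction for Off-site Data, Euclidean distance) method defines a modified polynomial $v_h(x)=\boldsymbol{\phi}(x)^T\mathbf{v}$ whose coefficients $\mathbf{v}$ minimize $\frac12\|\mathbf{v}-\mathbf{u}\|_2^2=\frac12\sum_{j=0}^p(v_j-u_j)^2$ subject to the constraint $v_h(\bar x)=u_D$. The linear system in the claim consists of the optimality conditions of the Lagrangian $\mathcal{L}(\mathbf{v},\lambda)=\frac12\|\mathbf{v}-\mathbf{u}\|_2^2+\lambda(v_h(\bar x)-u_D)$. The value $v_h(\tilde x)$ is the modified boundary condition imposed at $\tilde x$. *)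

theory Defs
  imports
    "HOL-Computational_Algebra.Polynomial"
    "Jordan_Normal_Form.Matrix"
    Complex_Main
begin

interpretation real_poly: vector_space "Polynomial.smult :: real \<Rightarrow> real poly \<Rightarrow> real poly"
  by unfold_locales (simp_all add: smult_add_left smult_add_right)

text \<open>A family, not a set: injectivity on the index set together with independence of the
  image is linear independence of the family.\<close>

definition is_basis_Pp :: "nat \<Rightarrow> (nat \<Rightarrow> real poly) \<Rightarrow> bool" where
  "is_basis_Pp p \<phi> \<longleftrightarrow>
     inj_on \<phi> {0..p} \<and>
     real_poly.independent (\<phi> ` {0..p}) \<and>
     real_poly.span (\<phi> ` {0..p}) = {q. degree q \<le> p}"

definition basis_vec :: "nat \<Rightarrow> (nat \<Rightarrow> real poly) \<Rightarrow> real \<Rightarrow> real vec" where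
  "basis_vec p \<phi> x = vec (p + 1) (\<lambda>n. poly (\<phi> n) x)"

definition dg_eval :: "nat \<Rightarrow> (nat \<Rightarrow> real poly) \<Rightarrow> real vec \<Rightarrow> real \<Rightarrow> real" where
  "dg_eval p \<phi> c x = basis_vec p \<phi> x \<bullet> c"

definition rode_matrix :: "nat \<Rightarrow> (nat \<Rightarrow> real poly) \<Rightarrow> real \<Rightarrow> real mat" where
  "rode_matrix p \<phi> xbar =
     (let \<Phi> = mat_of_cols (p + 1) [basis_vec p \<phi> xbar]
      in four_block_mat (1\<^sub>m (p + 1)) \<Phi> (transpose_mat \<Phi>) (0\<^sub>m 1 1))"

definition rode_solution ::
  "nat \<Rightarrow> (nat \<Rightarrow> real poly) \<Rightarrow> real \<Rightarrow> real vec \<Rightarrow> real \<Rightarrow> real vec \<Rightarrow> real \<Rightarrow> bool" where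
  "rode_solution p \<phi> xbar u uD v lam \<longleftrightarrow>
     v \<in> carrier_vec (p + 1) \<and>
     rode_matrix p \<phi> xbar *\<^sub>v (v @\<^sub>v vec_of_list [lam]) = u @\<^sub>v vec_of_list [uD]"

definition rode_alpha :: "nat \<Rightarrow> (nat \<Rightarrow> real poly) \<Rightarrow> real \<Rightarrow> real \<Rightarrow> real" where
  "rode_alpha p \<phi> xbar x =
     (basis_vec p \<phi> x \<bullet> basis_vec p \<phi> xbar) / (basis_vec p \<phi> xbar \<bullet> basis_vec p \<phi> xbar)"

definition rode_basis_vec :: "nat \<Rightarrow> (nat \<Rightarrow> real poly) \<Rightarrow> real \<Rightarrow> real \<Rightarrow> real vec" where
  "rode_basis_vec p \<phi> xbar x =
     basis_vec p \<phi> x - rode_alpha p \<phi> xbar x \<cdot>\<^sub>v basis_vec p \<phi> xbar"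

end

theory Submission
  imports Defs
begin

text \<open>Block elimination solves the system: its first block row gives
  \<open>v = u - \<lambda> \<phi>(xbar)\<close>, and inserting this in the constraint determines \<open>\<lambda>\<close>, because
  \<open>\<phi>(xbar) \<bullet> \<phi>(xbar) \<noteq> 0\<close>: otherwise all basis functions, hence all polynomials of degree at most
  \<open>p\<close>, would vanish at \<open>xbar\<close>, in contradiction to the constant polynomial 1. Pairing the
  resulting \<open>v\<close> with \<open>\<phi>(xtilde)\<close> gives the polynomial correction.\<close>

text \<open>Stated with \<open>Suc p\<close> because the simplifier rewrites \<open>p + 1\<close> to
  this form before the rule is tried.\<close>

lemma basis_vec_carrier [simp]: "basis_vec p \<phi> x \<in> carrier_vec (Suc p)"
  by (simp add: basis_vec_def)

lemma basis_vec_square_nonzero: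
  assumes "is_basis_Pp p \<phi>"
  shows "basis_vec p \<phi> x \<bullet> basis_vec p \<phi> x \<noteq> 0"
proof
  assume "basis_vec p \<phi> x \<bullet> basis_vec p \<phi> x = 0"
  \<comment> \<open>The sum stays whole, with no last summand split off, so that nonnegativity of
    the squares makes each of them vanish.\<close>
  then have "(\<Sum>i<Suc p. poly (\<phi> i) x * poly (\<phi> i) x) = 0"
    by (simp add: basis_vec_def scalar_prod_def atLeast0LessThan del: sum.lessThan_Suc)
  then have "poly (\<phi> i) x = 0" if "i < Suc p" for i
    using that by (subst (asm) sum_nonneg_eq_0_iff) auto
  then have "\<phi> ` {0..p} \<subseteq> {q. poly q x = 0}"
    by auto
  \<comment> \<open>The set is the kernel of the linear map that evaluates at
    \<open>x\<close>.\<close>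
  moreover have "real_poly.subspace {q. poly q x = 0}"
    by (simp add: real_poly.subspace_def)
  ultimately have "real_poly.span (\<phi> ` {0..p}) \<subseteq> {q. poly q x = 0}"
    by (rule real_poly.span_minimal)
  moreover have "1 \<in> real_poly.span (\<phi> ` {0..p})"
    using assms by (simp add: is_basis_Pp_def)
  ultimately show False
    by auto
qed

text \<open>Multiplying out block by block separates stationarity in \<open>v\<close> from the
  constraint, so that the later algebra needs only vectors and scalar products.\<close>

lemma rode_solution_iff_optimality:
  assumes u: "u \<in> carrier_vec (p + 1)"
  shows "rode_solution p \<phi> xbar u uD v lam \<longleftrightarrow>
    v \<in> carrier_vec (p + 1) \<and> v + lam \<cdot>\<^sub>v basis_vec p \<phi> xbar = u \<and> basis_vec p \<phi> xbar \<bullet> v = uD"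
proof (cases "v \<in> carrier_vec (p + 1)")
  case v: True
  define b where "b = basis_vec p \<phi> xbar"
  have b: "b \<in> carrier_vec (p + 1)"
    by (simp add: b_def)
  define B where "B = mat_of_cols (p + 1) [b]"
  have B: "B \<in> carrier_mat (p + 1) 1"
    by (simp add: B_def mat_of_cols_def)
  \<comment> \<open>As \<open>vec 1\<close>, the one-entry blocks can be compared entrywise, with 0
    as the only index.\<close>
  have single: "vec_of_list [c] = vec 1 (\<lambda>_. c)" for c :: real
    by (intro eq_vecI) (simp_all only: vec_of_list_index dim_vec_of_list dim_vec index_vec, auto)
  have row: "row B i = vec 1 (\<lambda>_. b $ i)" if "i < p + 1" for i
    using that B by (intro eq_vecI) (auto simp: B_def mat_of_cols_Cons_index_0)
  have col: "col B 0 = b"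
    using b B by (intro eq_vecI) (auto simp: B_def mat_of_cols_Cons_index_0)
  have Blam: "B *\<^sub>v vec 1 (\<lambda>_. lam) = lam \<cdot>\<^sub>v b"
    using b B by (intro eq_vecI) (auto simp: row scalar_prod_def mult.commute)
  have Bv: "transpose_mat B *\<^sub>v v = vec 1 (\<lambda>_. b \<bullet> v)"
    using B by (intro eq_vecI) (auto simp: col)
  have zero: "0\<^sub>m 1 1 *\<^sub>v vec 1 (\<lambda>_. lam) = 0\<^sub>v 1"
    by (intro eq_vecI) (auto simp: scalar_prod_def)
  have add_zero: "vec 1 (\<lambda>_. b \<bullet> v) + 0\<^sub>v 1 = vec 1 (\<lambda>_. b \<bullet> v)"
    by (intro eq_vecI) auto
  have "rode_matrix p \<phi> xbar *\<^sub>v (v @\<^sub>v vec 1 (\<lambda>_. lam))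
      = (1\<^sub>m (p + 1) *\<^sub>v v + B *\<^sub>v vec 1 (\<lambda>_. lam))
        @\<^sub>v (transpose_mat B *\<^sub>v v + 0\<^sub>m 1 1 *\<^sub>v vec 1 (\<lambda>_. lam))"
    unfolding rode_matrix_def Let_def b_def[symmetric] B_def[symmetric]
    using B v by (intro four_block_mat_mult_vec) auto
  also have "\<dots> = (v + lam \<cdot>\<^sub>v b) @\<^sub>v vec 1 (\<lambda>_. b \<bullet> v)"
    using v by (simp only: Blam Bv zero add_zero one_mult_mat_vec)
  finally have lhs: "rode_matrix p \<phi> xbar *\<^sub>v (v @\<^sub>v vec 1 (\<lambda>_. lam))
      = (v + lam \<cdot>\<^sub>v b) @\<^sub>v vec 1 (\<lambda>_. b \<bullet> v)" .
  \<comment> \<open>An equation of appended vectors splits into two only if the first parts have the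
    same length.\<close>
  have "v + lam \<cdot>\<^sub>v b \<in> carrier_vec (p + 1)"
    using v b by simp
  note eq = append_vec_eq[OF this u]
  have "vec 1 (\<lambda>_. b \<bullet> v) = vec 1 (\<lambda>_. uD) \<longleftrightarrow> b \<bullet> v = uD"
    by (auto dest: arg_cong[of _ _ "\<lambda>w. w $ 0"])
  then show ?thesis
    using v unfolding rode_solution_def single lhs eq b_def[symmetric] by blast
qed (simp add: rode_solution_def)

text \<open>As an equivalence with a closed form, the result of the elimination yields existence and
  uniqueness together.\<close>

lemma rode_solution_iff:
  fixes xbar :: real
  assumes basis: "is_basis_Pp p \<phi>" and u: "u \<in> carrier_vec (p + 1)"
  defines "b \<equiv> basis_vec p \<phi> xbar"
  shows "rode_solution p \<phi> xbar u uD v lam \<longleftrightarrow>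
    lam = (b \<bullet> u - uD) / (b \<bullet> b) \<and> v = u - lam \<cdot>\<^sub>v b"
proof -
  have b: "b \<in> carrier_vec (p + 1)" and bb: "b \<bullet> b \<noteq> 0"
    using basis_vec_square_nonzero[OF basis] by (simp_all add: b_def)
  \<comment> \<open>The dimension condition is absorbed: \<open>u - lam \<cdot>\<^sub>v b\<close>
    already has dimension \<open>p + 1\<close>.\<close>
  have "v \<in> carrier_vec (p + 1) \<and> v + lam \<cdot>\<^sub>v b = u \<longleftrightarrow> v = u - lam \<cdot>\<^sub>v b"
    using u b by auto
  moreover have "b \<bullet> (u - lam \<cdot>\<^sub>v b) = b \<bullet> u - lam * (b \<bullet> b)"
    using u b by (simp add: scalar_prod_minus_distrib[of _ "p + 1"])
  ultimately show ?thesis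
    using bb unfolding rode_solution_iff_optimality[OF u] b_def[symmetric]
    by (auto simp: field_simps)
qed

theorem proposition5p1:
  fixes p :: nat and \<phi> :: "nat \<Rightarrow> real poly"
    and xl xr \<Delta>x xtilde xbar d :: real
  assumes basis: "is_basis_Pp p \<phi>"
    and cell: "\<Delta>x = xr - xl" "\<Delta>x > 0"
    and xtilde: "xtilde \<in> {xl, xr}"
    and xbar: "xbar = xtilde + d" "d \<in> {-\<Delta>x..\<Delta>x}"
  shows "\<forall>u \<in> carrier_vec (p + 1). \<forall>uD :: real.
    (\<exists>!(v, lam). rode_solution p \<phi> xbar u uD v lam) \<and>
    (\<forall>v lam. rode_solution p \<phi> xbar u uD v lam \<longrightarrow>
       dg_eval p \<phi> v xtilde =
         rode_basis_vec p \<phi> xbar xtilde \<bullet> u + rode_alpha p \<phi> xbar xtilde * uD)"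
proof (intro ballI allI conjI impI)
  fix u :: "real vec" and uD :: real
  assume u: "u \<in> carrier_vec (p + 1)"
  note sol = rode_solution_iff[OF basis u]
  \<comment> \<open>In the closed form \<open>lam\<close> depends only on the data and
    \<open>v\<close> only on \<open>lam\<close> and the data.\<close>
  show "\<exists>!(v, lam). rode_solution p \<phi> xbar u uD v lam"
    unfolding sol by auto
  fix v lam
  define a b where "a = basis_vec p \<phi> xtilde" and "b = basis_vec p \<phi> xbar"
  have a: "a \<in> carrier_vec (p + 1)" and b: "b \<in> carrier_vec (p + 1)"
    by (simp_all add: a_def b_def)
  assume "rode_solution p \<phi> xbar u uD v lam"
  then have lam: "lam = (b \<bullet> u - uD) / (b \<bullet> b)" and v: "v = u - lam \<cdot>\<^sub>v b"
    by (simp_all add: sol b_def)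
  have "dg_eval p \<phi> v xtilde = a \<bullet> u - lam * (a \<bullet> b)"
    using u a b unfolding dg_eval_def a_def[symmetric] v
    by (simp add: scalar_prod_minus_distrib[of _ "p + 1"])
  \<comment> \<open>Inserting \<open>lam\<close> splits off the part linear in \<open>uD\<close>,
    whose coefficient is \<open>rode_alpha\<close>.\<close>
  also have "\<dots> = (a \<bullet> u - (a \<bullet> b) / (b \<bullet> b) * (b \<bullet> u)) + (a \<bullet> b) / (b \<bullet> b) * uD"
    by (simp add: lam algebra_simps diff_divide_distrib)
  \<comment> \<open>Bilinearity gathers the rest into one pairing with \<open>u\<close>, whose other
    factor is \<open>rode_basis_vec\<close>.\<close>
  also have "a \<bullet> u - (a \<bullet> b) / (b \<bullet> b) * (b \<bullet> u) = (a - ((a \<bullet> b) / (b \<bullet> b)) \<cdot>\<^sub>v b) \<bullet> u"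
    using u a b by (simp add: minus_scalar_prod_distrib[of _ "p + 1"])
  finally show "dg_eval p \<phi> v xtilde =
      rode_basis_vec p \<phi> xbar xtilde \<bullet> u + rode_alpha p \<phi> xbar xtilde * uD"
    by (simp add: rode_basis_vec_def rode_alpha_def a_def b_def)
qed

end
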